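(* Let $(X,\alpha,\leq,\wedge,\vee)$ be a $\mathbb Z_2$-decreasing lattice. Assume that $X$ is locally convex with respect to $\leq$, countably Dini, and $\sigma$-monotonically conditionally complete. If $X$ admits either an RS-order-preserving arithmetic mean or an LS-order-preserving harmonic mean (arithmetic and harmonic being understood with respect to $\alpha$), then $X$ admits an equivariant mean. If, in addition, $X$ is an AR (respectively, an AE), then $(X,\alpha)$ is a $\mathbb Z_2$-AR (respectively, a $\mathbb Z_2$-AE).
   Context: All spaces are Hausdorff. An involution on a space $X$ is a continuous map $\alpha:X\to X$ with $\alpha\circ\alpha=1_X$; it corresponds to an action of $\mathbb Z_2=\{-1,1\}$ with $-1\cdot x=\alpha(x)$, and $(X,\alpha)$ denotes this $\mathbb Z_2$-space. A subset $A$ is invariant if $\alpha(A)=A$; a function $f:(X,\alpha)\to(Y,\beta)$ is equivariant if $f\circ\alpha=\beta\circ f$. A topological lattice is a Hausdorff space $X$ with a lattice structure $(X,\leq,\wedge,\vee)$ such that $\wedge,\vee:X\times X\to X$ are continuous. A $\mathbb Z_2$-decreasing lattice $(X,\alpha,\leq,\wedge,\vee)$ is a topological lattice with an involution $\alpha:X\to X$ such that $x\leq y$ implies $\alpha(y)\leq\alpha(x)$. We write $x<y$ for $x\leq y$ and $x\neq y$. For $x\le y$, $[x;y]=\{a\in X:x\leq a\leq y\}$; $A\subseteq X$ is convex with respect to $\leq$ if $[x;y]\subseteq A$ whenever $x,y\in A$ and $x\leq y$; $X$ is locally convex with respect to $\leq$ if its topology has a basis of sets convex with respect to $\leq$. $X$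 is $\sigma$-monotonically conditionally complete if every monotonically increasing sequence bounded from above has a supremum in $X$ and every monotonically decreasing sequence bounded from below has an infimum in $X$. $X$ is countably Dini if every monotonically increasing sequence in $X$ that has a supremum converges to its supremum. A mean on $X$ is a continuous map $q:X\times X\to X$ with $q(x,x)=x$ and $q(x,y)=q(y,x)$ for all $x,y$. It is equivariant if $q(\alpha(x),\alpha(y))=\alpha(q(x,y))$ for all $x,y$. A mean $q$ is order-preserving if $x\leq q(x,y)\leq y$ whenever $x\leq y$; an order-preserving mean is LS-order-preserving if $x<q(x,y)\leq y$ whenever $x<y$, and RS-order-preserving if $x\leq q(x,y)<y$ whenever $x<y$. Put $q^\alpha(x,y):=\alpha(q(\alpha(x),\alpha(y)))$. The mean $q$ is arithmetic with respect to $\alpha$ if $q^\alpha(x,y)\leq q(x,y)$ for all $x,y$, and harmonic with respect to $\alpha$ if $q(x,y)\leq q^\alpha(x,y)$ for all $x,y$. A $\mathbb Z_2$-space $Y$ is a $\mathbb Z_2$-AE if for every metrizable $\mathbb Z_2$-space $Z$, every closed invariant $A\subseteq Z$ and every continuous equivariant $f:A\to Y$ there is a continuous equivariant $F:Z\to Y$ with $F|_A=f$. A metrizable $\mathbb Z_2$-space $Y$ is a $\mathbb Z_2$-AR if for every metrizable $\mathbb Z_2$-space $Z$ containing $Y$ as a closed invariant subset there is a continuous equivariant retraction $Z\to Y$. AE and AR are the same notions without group action; in particular an AR is metrizable. *)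

theory Defs
  imports "HOL-Analysis.Analysis" "HOL-Library.Lub_Glb"
begin

section \<open>Involutions and equivariant maps\<close>

definition involution :: "'a topology \<Rightarrow> ('a \<Rightarrow> 'a) \<Rightarrow> bool" where
  "involution X \<alpha> \<longleftrightarrow> continuous_map X X \<alpha> \<and> (\<forall>x\<in>topspace X. \<alpha> (\<alpha> x) = x)"

definition invariant_under :: "('a \<Rightarrow> 'a) \<Rightarrow> 'a set \<Rightarrow> bool" where
  "invariant_under \<alpha> A \<longleftrightarrow> \<alpha> ` A = A"

definition equivariant_on ::
    "'a set \<Rightarrow> ('a \<Rightarrow> 'a) \<Rightarrow> ('b \<Rightarrow> 'b) \<Rightarrow> ('a \<Rightarrow> 'b) \<Rightarrow> bool" where
  "equivariant_on A \<alpha> \<beta> f \<longleftrightarrow> (\<forall>x\<in>A. f (\<alpha> x) = \<beta> (f x))"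


section \<open>Topological lattices with a decreasing involution\<close>

definition topological_lattice :: "'a::{t2_space, lattice} itself \<Rightarrow> bool" where
  "topological_lattice _ \<longleftrightarrow>
     continuous_on UNIV (\<lambda>(x::'a, y). inf x y) \<and> continuous_on UNIV (\<lambda>(x::'a, y). sup x y)"

definition Z2_decreasing_lattice :: "('a::{t2_space, lattice} \<Rightarrow> 'a) \<Rightarrow> bool" where
  "Z2_decreasing_lattice \<alpha> \<longleftrightarrow>
     topological_lattice TYPE('a) \<and> involution euclidean \<alpha> \<and> (\<forall>x y. x \<le> y \<longrightarrow> \<alpha> y \<le> \<alpha> x)"

definition order_convex :: "'a::order set \<Rightarrow> bool" where
  "order_convex A \<longleftrightarrow> (\<forall>x\<in>A. \<forall>y\<in>A. x \<le> y \<longrightarrow> {x..y} \<subseteq> A)"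

definition locally_order_convex :: "'a::{topological_space, order} itself \<Rightarrow> bool" where
  "locally_order_convex _ \<longleftrightarrow>
     (\<exists>B::'a set set. topological_basis B \<and> (\<forall>A\<in>B. order_convex A))"

definition sigma_monotonically_conditionally_complete :: "'a::order itself \<Rightarrow> bool" where
  "sigma_monotonically_conditionally_complete _ \<longleftrightarrow>
     (\<forall>s::nat \<Rightarrow> 'a. incseq s \<and> bdd_above (range s) \<longrightarrow> (\<exists>x. isLub UNIV (range s) x)) \<and>
     (\<forall>s::nat \<Rightarrow> 'a. decseq s \<and> bdd_below (range s) \<longrightarrow> (\<exists>x. isGlb UNIV (range s) x))"

definition countably_Dini :: "'a::{topological_space, order} itself \<Rightarrow> bool" where
  "countably_Dini _ \<longleftrightarrow>
     (\<forall>(s::nat \<Rightarrow> 'a) x. incseq s \<and> isLub UNIV (range s) x \<longrightarrow> s \<longlonglongrightarrow> x)"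


section \<open>Means\<close>

definition is_mean :: "('a::topological_space \<times> 'a \<Rightarrow> 'a) \<Rightarrow> bool" where
  "is_mean q \<longleftrightarrow>
     continuous_on UNIV q \<and> (\<forall>x. q (x, x) = x) \<and> (\<forall>x y. q (x, y) = q (y, x))"

definition equivariant_mean ::
    "('a::topological_space \<Rightarrow> 'a) \<Rightarrow> ('a \<times> 'a \<Rightarrow> 'a) \<Rightarrow> bool" where
  "equivariant_mean \<alpha> q \<longleftrightarrow> is_mean q \<and> (\<forall>x y. q (\<alpha> x, \<alpha> y) = \<alpha> (q (x, y)))"

definition order_preserving_mean ::
    "('a::{topological_space, order} \<times> 'a \<Rightarrow> 'a) \<Rightarrow> bool" where
  "order_preserving_mean q \<longleftrightarrow>
     is_mean q \<and> (\<forall>x y. x \<le> y \<longrightarrow> x \<le> q (x, y) \<and> q (x, y) \<le> y)"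

definition LS_order_preserving_mean ::
    "('a::{topological_space, order} \<times> 'a \<Rightarrow> 'a) \<Rightarrow> bool" where
  "LS_order_preserving_mean q \<longleftrightarrow>
     order_preserving_mean q \<and> (\<forall>x y. x < y \<longrightarrow> x < q (x, y) \<and> q (x, y) \<le> y)"

definition RS_order_preserving_mean ::
    "('a::{topological_space, order} \<times> 'a \<Rightarrow> 'a) \<Rightarrow> bool" where
  "RS_order_preserving_mean q \<longleftrightarrow>
     order_preserving_mean q \<and> (\<forall>x y. x < y \<longrightarrow> x \<le> q (x, y) \<and> q (x, y) < y)"

definition conjugate_mean :: "('a \<Rightarrow> 'a) \<Rightarrow> ('a \<times> 'a \<Rightarrow> 'a) \<Rightarrow> 'a \<times> 'a \<Rightarrow> 'a" where
  "conjugate_mean \<alpha> q = (\<lambda>(x, y). \<alpha> (q (\<alpha> x, \<alpha> y)))"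

definition arithmetic_wrt ::
    "('a::order \<Rightarrow> 'a) \<Rightarrow> ('a \<times> 'a \<Rightarrow> 'a) \<Rightarrow> bool" where
  "arithmetic_wrt \<alpha> q \<longleftrightarrow> (\<forall>x y. conjugate_mean \<alpha> q (x, y) \<le> q (x, y))"

definition harmonic_wrt ::
    "('a::order \<Rightarrow> 'a) \<Rightarrow> ('a \<times> 'a \<Rightarrow> 'a) \<Rightarrow> bool" where
  "harmonic_wrt \<alpha> q \<longleftrightarrow> (\<forall>x y. q (x, y) \<le> conjugate_mean \<alpha> q (x, y))"


section \<open>Absolute extensors and absolute retracts\<close>

text \<open>
  HOL cannot quantify over types inside a formula, so each notion takes the type \<open>'z\<close> carrying the
  test spaces as a parameter: \<open>Z\<close> ranges over all metrizable topologies on all subsets of \<open>'z\<close>.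
  The usual notion is the conjunction over all types \<open>'z\<close>.

  The retract notions speak of a closed embedding \<open>e\<close> of \<open>Y\<close> into \<open>Z\<close>, since \<open>Y\<close> and \<open>Z\<close> live on
  different types; \<open>r\<close> is a retraction onto the copy \<open>e ` topspace Y\<close> of \<open>Y\<close>, read as a map into \<open>Y\<close>.
  The constant \<open>AR\<close> of HOL-Analysis is not used: it only tests subsets of \<open>'a \<times> real\<close>.
\<close>

definition absolute_extensor :: "'z itself \<Rightarrow> 'a topology \<Rightarrow> bool" where
  "absolute_extensor _ Y \<longleftrightarrow>
     (\<forall>(Z::'z topology) A f.
        metrizable_space Z \<and> closedin Z A \<and> continuous_map (subtopology Z A) Y f \<longrightarrow>
        (\<exists>F. continuous_map Z Y F \<and> (\<forall>a\<in>A. F a = f a)))"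

definition Z2_absolute_extensor :: "'z itself \<Rightarrow> 'a topology \<Rightarrow> ('a \<Rightarrow> 'a) \<Rightarrow> bool" where
  "Z2_absolute_extensor _ Y \<alpha> \<longleftrightarrow>
     (\<forall>(Z::'z topology) \<gamma> A f.
        metrizable_space Z \<and> involution Z \<gamma> \<and>
        closedin Z A \<and> invariant_under \<gamma> A \<and>
        continuous_map (subtopology Z A) Y f \<and> equivariant_on A \<gamma> \<alpha> f \<longrightarrow>
        (\<exists>F. continuous_map Z Y F \<and> equivariant_on (topspace Z) \<gamma> \<alpha> F \<and> (\<forall>a\<in>A. F a = f a)))"

definition closed_embedding :: "'a topology \<Rightarrow> 'b topology \<Rightarrow> ('a \<Rightarrow> 'b) \<Rightarrow> bool" where
  "closed_embedding Y Z e \<longleftrightarrow> embedding_map Y Z e \<and> closedin Z (e ` topspace Y)"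

definition absolute_retract :: "'z itself \<Rightarrow> 'a topology \<Rightarrow> bool" where
  "absolute_retract _ Y \<longleftrightarrow>
     metrizable_space Y \<and>
     (\<forall>(Z::'z topology) e.
        metrizable_space Z \<and> closed_embedding Y Z e \<longrightarrow>
        (\<exists>r. continuous_map Z Y r \<and> (\<forall>y\<in>topspace Y. r (e y) = y)))"

text \<open>Equivariance of \<open>e\<close> makes \<open>e ` topspace Y\<close> invariant and its action that of \<open>Y\<close>.\<close>

definition Z2_absolute_retract :: "'z itself \<Rightarrow> 'a topology \<Rightarrow> ('a \<Rightarrow> 'a) \<Rightarrow> bool" where
  "Z2_absolute_retract _ Y \<alpha> \<longleftrightarrow>
     metrizable_space Y \<and>
     (\<forall>(Z::'z topology) \<gamma> e.
        metrizable_space Z \<and> involution Z \<gamma> \<and>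
        closed_embedding Y Z e \<and> equivariant_on (topspace Y) \<alpha> \<gamma> e \<longrightarrow>
        (\<exists>r. continuous_map Z Y r \<and> equivariant_on (topspace Z) \<gamma> \<alpha> r \<and>
             (\<forall>y\<in>topspace Y. r (e y) = y)))"

end

theory Submission
  imports Defs
begin

text \<open>
  The equivariant mean is a compound mean in the style of Gauss's arithmetic-geometric mean.  Let
  \<open>q\<close> be an RS-order-preserving arithmetic mean and \<open>q\<^sup>\<alpha>\<close> its conjugate.  Replacing a pair \<open>p\<close> by
  \<open>(q\<^sup>\<alpha> p, q p)\<close> again and again produces, from the first step on, shrinking order intervals
  \<open>[a\<^sub>n; b\<^sub>n]\<close>: the pair is ordered because \<open>q\<close> is arithmetic, and the new interval lies in the old
  one because both means preserve the order.  Conditional completeness supplies \<open>a = sup a\<^sub>n\<close> and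
  \<open>b = inf b\<^sub>n\<close>, and the Dini property turns both into limits.  Passing to the limit in
  \<open>b\<^sub>n\<^sub>+\<^sub>1 = q (a\<^sub>n, b\<^sub>n)\<close> gives \<open>b = q (a, b)\<close>, which the strict inequality of an RS-order-preserving
  mean allows only for \<open>a = b\<close> (lemma \<open>compound_mean_limit\<close>).

  The common limit depends continuously on the initial pair: it is squeezed between the endpoints
  \<open>a\<^sub>n, b\<^sub>n\<close>, each of which is continuous, so an order-convex neighbourhood that contains both
  endpoints contains the limit.  It is equivariant since \<open>\<alpha>\<close> reverses the order and exchanges \<open>q\<close>
  with \<open>q\<^sup>\<alpha>\<close>, hence exchanges the two endpoints.  An LS-order-preserving harmonic mean reduces to
  this case because its conjugate is RS-order-preserving and arithmetic.

  Finally, an equivariant mean \<open>m\<close> turns every continuous map \<open>F\<close> from a space with involution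
  \<open>\<gamma>\<close> into the equivariant map \<open>z \<mapsto> m (F z, \<alpha> (F (\<gamma> z)))\<close> without changing \<open>F\<close> at the points where
  it is already equivariant.  Applied to a nonequivariant extension or retraction, this averaging
  yields an equivariant one.
\<close>

section \<open>Order-reversing involutions and conjugate means\<close>

locale Z2_lattice =
  fixes \<alpha> :: "'a::{t2_space, lattice} \<Rightarrow> 'a"
  assumes Z2_lattice: "Z2_decreasing_lattice \<alpha>"
begin

lemma involutive [simp]: "\<alpha> (\<alpha> x) = x"
  using Z2_lattice by (simp add: Z2_decreasing_lattice_def involution_def)

lemma involution: "involution euclidean \<alpha>"
  using Z2_lattice by (simp add: Z2_decreasing_lattice_def)

lemma antitone: "x \<le> y \<Longrightarrow> \<alpha> y \<le> \<alpha> x"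
  using Z2_lattice by (simp add: Z2_decreasing_lattice_def)

lemma le_involution_iff [simp]: "\<alpha> x \<le> \<alpha> y \<longleftrightarrow> y \<le> x"
  by (metis antitone involutive)

lemma less_involution_iff [simp]: "\<alpha> x < \<alpha> y \<longleftrightarrow> y < x"
  by (simp add: less_le_not_le)

lemma continuous_involution: "continuous_on UNIV \<alpha>"
  using involution by (simp add: involution_def)

lemma tendsto_involution: "(s \<longlongrightarrow> x) F \<Longrightarrow> ((\<lambda>n. \<alpha> (s n)) \<longlongrightarrow> \<alpha> x) F"
  using continuous_on_tendsto_compose[OF continuous_involution] by simp

text \<open>
  The Dini property speaks of increasing sequences only; the continuous order-reversing involution
  carries it over to decreasing ones.
\<close>

lemma decseq_Glb_tendsto:
  fixes s :: "nat \<Rightarrow> 'a"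
  assumes Dini: "countably_Dini TYPE('a)"
    and s: "decseq s" "isGlb UNIV (range s) x"
  shows "s \<longlonglongrightarrow> x"
proof -
  have "incseq (\<lambda>n. \<alpha> (s n))"
    using s(1) by (simp add: incseq_def decseq_def)
  moreover have "isLub UNIV (range (\<lambda>n. \<alpha> (s n))) (\<alpha> x)"
  proof (rule isLubI2)
    show "isUb UNIV (range (\<lambda>n. \<alpha> (s n))) (\<alpha> x)"
      using s(2) by (auto simp: isGlb_def greatestP_def isLb_def isUb_def setge_def setle_def)
    have "\<alpha> x \<le> u" if "\<And>n. \<alpha> (s n) \<le> u" for u
    proof -
      have "\<alpha> u \<le> s n" for n
        using antitone[OF that[of n]] by simp
      then have "\<alpha> u \<le> x"
        using s(2) by (auto simp: isGlb_def greatestP_def isLb_def setge_def setle_def)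
      then show ?thesis
        using antitone[of "\<alpha> u" x] by simp
    qed
    then show "\<alpha> x <=* Collect (isUb UNIV (range (\<lambda>n. \<alpha> (s n))))"
      by (auto simp: isUb_def setle_def setge_def)
  qed
  ultimately have "(\<lambda>n. \<alpha> (s n)) \<longlonglongrightarrow> \<alpha> x"
    using Dini by (auto simp: countably_Dini_def)
  from tendsto_involution[OF this] show ?thesis
    by simp
qed

lemma conjugate_conjugate [simp]: "conjugate_mean \<alpha> (conjugate_mean \<alpha> q) = q"
  by (auto simp: conjugate_mean_def)

lemma is_mean_conjugate:
  assumes "is_mean q"
  shows "is_mean (conjugate_mean \<alpha> q)"
proof -
  have q: "continuous_on UNIV q" "q (x, x) = x" "q (x, y) = q (y, x)" for x y
    using assms unfolding is_mean_def by blast+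
  have "continuous_on UNIV (\<lambda>p. \<alpha> (q (\<alpha> (fst p), \<alpha> (snd p))))"
    by (intro continuous_on_compose2[OF continuous_involution]
        continuous_on_compose2[OF q(1)] continuous_intros) auto
  then show ?thesis
    using q by (simp add: is_mean_def conjugate_mean_def case_prod_beta')
qed

lemma order_preserving_conjugate:
  assumes "order_preserving_mean q"
  shows "order_preserving_mean (conjugate_mean \<alpha> q)"
proof -
  have m: "is_mean q" and le: "x \<le> y \<Longrightarrow> x \<le> q (x, y) \<and> q (x, y) \<le> y" for x y
    using assms unfolding order_preserving_mean_def by blast+
  have sym: "q (x, y) = q (y, x)" for x y
    using m unfolding is_mean_def by blast
  have "x \<le> \<alpha> (q (\<alpha> x, \<alpha> y)) \<and> \<alpha> (q (\<alpha> x, \<alpha> y)) \<le> y" if "x \<le> y" for x y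
    using le[of "\<alpha> y" "\<alpha> x"] that antitone[of "q (\<alpha> x, \<alpha> y)" "\<alpha> x"]
      antitone[of "\<alpha> y" "q (\<alpha> x, \<alpha> y)"] sym[of "\<alpha> x" "\<alpha> y"] by simp
  then show ?thesis
    using is_mean_conjugate[OF m] by (simp add: order_preserving_mean_def conjugate_mean_def)
qed

text \<open>
  Conjugation turns an LS-order-preserving harmonic mean into an RS-order-preserving arithmetic one,
  so that only the latter kind has to be treated.
\<close>

lemma RS_conjugate_of_LS:
  assumes "LS_order_preserving_mean q"
  shows "RS_order_preserving_mean (conjugate_mean \<alpha> q)"
proof -
  have m: "order_preserving_mean q" and lt: "x < y \<Longrightarrow> x < q (x, y)" for x y
    using assms unfolding LS_order_preserving_mean_def by blast+
  have sym: "q (x, y) = q (y, x)" for x y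
    using m unfolding order_preserving_mean_def is_mean_def by blast
  have "conjugate_mean \<alpha> q (x, y) < y" if "x < y" for x y
  proof -
    have "\<alpha> y < q (\<alpha> x, \<alpha> y)"
      using lt[of "\<alpha> y" "\<alpha> x"] sym[of "\<alpha> x" "\<alpha> y"] that by simp
    then have "\<alpha> (q (\<alpha> x, \<alpha> y)) < \<alpha> (\<alpha> y)"
      unfolding less_involution_iff .
    then show ?thesis
      by (simp add: conjugate_mean_def)
  qed
  with order_preserving_conjugate[OF m] show ?thesis
    by (auto simp: RS_order_preserving_mean_def order_preserving_mean_def)
qed

lemma arithmetic_conjugate_iff: "arithmetic_wrt \<alpha> (conjugate_mean \<alpha> q) \<longleftrightarrow> harmonic_wrt \<alpha> q"
  by (simp add: arithmetic_wrt_def harmonic_wrt_def)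

end

section \<open>The compound mean\<close>

locale compound_mean = Z2_lattice \<alpha> for \<alpha> :: "'a::{t2_space, lattice} \<Rightarrow> 'a" +
  fixes q :: "'a \<times> 'a \<Rightarrow> 'a"
  assumes convex: "locally_order_convex TYPE('a)"
    and Dini: "countably_Dini TYPE('a)"
    and complete: "sigma_monotonically_conditionally_complete TYPE('a)"
    and RS: "RS_order_preserving_mean q"
    and arithmetic: "arithmetic_wrt \<alpha> q"
begin

abbreviation q\<alpha> :: "'a \<times> 'a \<Rightarrow> 'a" where
  "q\<alpha> \<equiv> conjugate_mean \<alpha> q"

text \<open>
  The iteration starts with the images of the given pair and not with the pair itself, which need not
  be ordered; this makes every \<open>ends n p\<close> the two ends of an order interval.
\<close>

primrec ends :: "nat \<Rightarrow> 'a \<times> 'a \<Rightarrow> 'a \<times> 'a" where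
  "ends 0 p = (q\<alpha> p, q p)"
| "ends (Suc n) p = (q\<alpha> (ends n p), q (ends n p))"

abbreviation lo :: "nat \<Rightarrow> 'a \<times> 'a \<Rightarrow> 'a" where "lo n p \<equiv> fst (ends n p)"
abbreviation hi :: "nat \<Rightarrow> 'a \<times> 'a \<Rightarrow> 'a" where "hi n p \<equiv> snd (ends n p)"

definition M :: "'a \<times> 'a \<Rightarrow> 'a" where
  "M p = lim (\<lambda>n. hi n p)"

lemma order_preserving: "order_preserving_mean q"
  using RS by (simp add: RS_order_preserving_mean_def)

lemma mean: "is_mean q"
  using order_preserving by (simp add: order_preserving_mean_def)

lemma mean_conjugate: "is_mean q\<alpha>"
  by (rule is_mean_conjugate[OF mean])

lemma q_commute: "q (x, y) = q (y, x)"
  using mean unfolding is_mean_def by blast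

lemma q\<alpha>_commute: "q\<alpha> (x, y) = q\<alpha> (y, x)"
  using mean_conjugate unfolding is_mean_def by blast

lemma continuous_q: "continuous_on UNIV q"
  using mean by (simp add: is_mean_def)

lemma continuous_q\<alpha>: "continuous_on UNIV q\<alpha>"
  using mean_conjugate by (simp add: is_mean_def)

lemma q\<alpha>_le_q: "q\<alpha> p \<le> q p"
  using arithmetic by (cases p) (simp add: arithmetic_wrt_def)

lemma lo_le_hi: "lo n p \<le> hi n p"
  by (cases n) (simp_all add: q\<alpha>_le_q)

lemma lo_le_Suc: "lo n p \<le> lo (Suc n) p"
  using order_preserving_conjugate[OF order_preserving] lo_le_hi[of n p]
  by (simp add: order_preserving_mean_def) (metis prod.collapse)

lemma hi_Suc_le: "hi (Suc n) p \<le> hi n p"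
  using order_preserving lo_le_hi[of n p]
  by (simp add: order_preserving_mean_def) (metis prod.collapse)

lemma incseq_lo: "incseq (\<lambda>n. lo n p)"
  by (rule incseq_SucI) (rule lo_le_Suc)

lemma decseq_hi: "decseq (\<lambda>n. hi n p)"
  by (rule decseq_SucI) (rule hi_Suc_le)

lemma lo_le_hi_any: "lo m p \<le> hi n p"
proof -
  have "lo m p \<le> lo (max m n) p"
    using incseq_lo[of p] by (simp add: incseq_def)
  also have "\<dots> \<le> hi (max m n) p"
    by (rule lo_le_hi)
  also have "\<dots> \<le> hi n p"
    using decseq_hi[of p] by (simp add: decseq_def)
  finally show ?thesis .
qed

text \<open>
  The supremum \<open>a\<close> of the lower ends and the infimum \<open>b\<close> of the upper ends satisfy \<open>q (a, b) = b\<close>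
  by continuity, so \<open>a < b\<close> would contradict the strictness of \<open>q\<close> at its right argument.
\<close>

lemma compound_mean_limit:
  "(\<lambda>n. lo n p) \<longlonglongrightarrow> M p" "(\<lambda>n. hi n p) \<longlonglongrightarrow> M p" "lo n p \<le> M p" "M p \<le> hi n p"
proof -
  have ex_Lub: "\<exists>x. isLub UNIV (range s) x"
    if "incseq s" "bdd_above (range s)" for s :: "nat \<Rightarrow> 'a"
    using complete that by (simp add: sigma_monotonically_conditionally_complete_def)
  have ex_Glb: "\<exists>x. isGlb UNIV (range s) x"
    if "decseq s" "bdd_below (range s)" for s :: "nat \<Rightarrow> 'a"
    using complete that by (simp add: sigma_monotonically_conditionally_complete_def)
  have "bdd_above (range (\<lambda>n. lo n p))"
    by (rule bdd_aboveI2[where M = "hi 0 p"]) (rule lo_le_hi_any)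
  then obtain a where a: "isLub UNIV (range (\<lambda>n. lo n p)) a"
    using ex_Lub[OF incseq_lo] by blast
  have "bdd_below (range (\<lambda>n. hi n p))"
    by (rule bdd_belowI2[where m = "lo 0 p"]) (rule lo_le_hi_any)
  then obtain b where b: "isGlb UNIV (range (\<lambda>n. hi n p)) b"
    using ex_Glb[OF decseq_hi] by blast
  have lo_a: "(\<lambda>n. lo n p) \<longlonglongrightarrow> a"
    using Dini incseq_lo[of p] a by (auto simp: countably_Dini_def)
  have hi_b: "(\<lambda>n. hi n p) \<longlonglongrightarrow> b"
    using decseq_Glb_tendsto[OF Dini decseq_hi b] .
  have lo_le: "lo n p \<le> a" for n
    using a by (auto simp: isLub_def leastP_def isUb_def setle_def)
  have le_hi: "b \<le> hi n p" for n
    using b by (auto simp: isGlb_def greatestP_def isLb_def setge_def)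
  have "a \<le> hi n p" for n
    using a lo_le_hi_any[of _ p n] by (auto simp: isLub_def leastP_def isUb_def setle_def setge_def)
  then have "a \<le> b"
    using b by (auto simp: isGlb_def greatestP_def isLb_def setge_def setle_def)
  have "(\<lambda>n. q (ends n p)) \<longlonglongrightarrow> q (a, b)"
    using continuous_on_tendsto_compose[OF continuous_q tendsto_Pair[OF lo_a hi_b]] by simp
  moreover have "(\<lambda>n. q (ends n p)) \<longlonglongrightarrow> b"
    using LIMSEQ_Suc[OF hi_b] by simp
  ultimately have "q (a, b) = b"
    by (rule LIMSEQ_unique)
  with \<open>a \<le> b\<close> have "a = b"
    using RS by (metis RS_order_preserving_mean_def order_less_irrefl order_le_less)
  moreover have "M p = b"
    unfolding M_def using hi_b by (rule limI)
  ultimately show "(\<lambda>n. lo n p) \<longlonglongrightarrow> M p" "(\<lambda>n. hi n p) \<longlonglongrightarrow> M p" "lo n p \<le> M p" "M p \<le> hi n p"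
    using lo_a hi_b lo_le le_hi by simp_all
qed

lemma continuous_ends: "continuous_on UNIV (ends n)"
proof (induction n)
  case 0
  show ?case
    using continuous_on_Pair[OF continuous_q\<alpha> continuous_q] by simp
next
  case (Suc n)
  have "continuous_on UNIV (\<lambda>p. (q\<alpha> (ends n p), q (ends n p)))"
    by (intro continuous_on_Pair continuous_on_compose2[OF continuous_q\<alpha> Suc]
        continuous_on_compose2[OF continuous_q Suc]) auto
  then show ?case
    by simp
qed

text \<open>
  Order-convexity of a neighbourhood of \<open>M p\<close> replaces any uniformity of the convergence: once both
  ends of a single interval lie in it, so does the value of \<open>M\<close> squeezed between them.
\<close>

lemma continuous_M: "continuous_on UNIV M"
proof -
  have "eventually (\<lambda>p'. M p' \<in> U) (at p)" if U: "open U" "M p \<in> U" for p U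
  proof -
    obtain B :: "'a set set" where B: "topological_basis B" "\<forall>A\<in>B. order_convex A"
      using convex by (auto simp: locally_order_convex_def)
    obtain V where V: "V \<in> B" "M p \<in> V" "V \<subseteq> U"
      using topological_basisE[OF B(1) U] .
    have "open V"
      using topological_basis_open[OF B(1) V(1)] .
    have "eventually (\<lambda>n. lo n p \<in> V) sequentially" "eventually (\<lambda>n. hi n p \<in> V) sequentially"
      using compound_mean_limit(1,2)[of p] \<open>open V\<close> V(2) by (auto dest: topological_tendstoD)
    then have "eventually (\<lambda>n. ends n p \<in> V \<times> V) sequentially"
      by eventually_elim (auto simp: mem_Times_iff)
    then obtain n where n: "ends n p \<in> V \<times> V"
      unfolding eventually_sequentially by blast
    have "(ends n \<longlongrightarrow> ends n p) (at p)"
      using continuous_ends[of n] unfolding continuous_on_def by blast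
    then have "eventually (\<lambda>p'. ends n p' \<in> V \<times> V) (at p)"
      using open_Times[OF \<open>open V\<close> \<open>open V\<close>] n by (rule topological_tendstoD)
    then show ?thesis
    proof eventually_elim
      case (elim p')
      have "order_convex V"
        using B(2) V(1) by blast
      then have "{lo n p'..hi n p'} \<subseteq> V"
        using elim lo_le_hi[of n p'] by (auto simp: order_convex_def mem_Times_iff)
      then show ?case
        using compound_mean_limit(3,4)[where n = n and p = p'] V(3) by auto
    qed
  qed
  then show ?thesis
    unfolding continuous_on_def by (blast intro: topological_tendstoI)
qed

lemma ends_commute: "ends n (x, y) = ends n (y, x)"
  by (induction n) (simp_all add: q_commute q\<alpha>_commute)

lemma ends_diagonal: "ends n (x, x) = (x, x)"
proof -
  have "q (x, x) = x" "q\<alpha> (x, x) = x"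
    using mean mean_conjugate unfolding is_mean_def by blast+
  then show ?thesis
    by (induction n) simp_all
qed

lemma ends_involution: "ends n (\<alpha> x, \<alpha> y) = (\<alpha> (hi n (x, y)), \<alpha> (lo n (x, y)))"
proof -
  have q: "q (\<alpha> u, \<alpha> v) = \<alpha> (q\<alpha> (u, v))" and q\<alpha>: "q\<alpha> (\<alpha> u, \<alpha> v) = \<alpha> (q (u, v))" for u v
    by (simp_all add: conjugate_mean_def)
  show ?thesis
  proof (induction n)
    case 0
    show ?case
      by (simp add: q q\<alpha>)
  next
    case (Suc n)
    \<comment> \<open>The ends arrive in reverse order, which the commutativity of both means undoes.\<close>
    have "q (\<alpha> (hi n (x, y)), \<alpha> (lo n (x, y))) = \<alpha> (q\<alpha> (ends n (x, y)))"
      "q\<alpha> (\<alpha> (hi n (x, y)), \<alpha> (lo n (x, y))) = \<alpha> (q (ends n (x, y)))"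
      unfolding q q\<alpha> by (simp_all add: q_commute[of "hi n (x, y)"] q\<alpha>_commute[of "hi n (x, y)"])
    then show ?case
      by (simp add: Suc)
  qed
qed

theorem equivariant_mean_M: "equivariant_mean \<alpha> M"
proof -
  have "M (x, x) = x" for x
    unfolding M_def ends_diagonal by (simp add: limI)
  moreover have "M (x, y) = M (y, x)" for x y
    unfolding M_def by (simp only: ends_commute[of _ x y])
  moreover have "M (\<alpha> x, \<alpha> y) = \<alpha> (M (x, y))" for x y
    unfolding M_def[of "(\<alpha> x, \<alpha> y)"] ends_involution snd_conv
    by (intro limI tendsto_involution compound_mean_limit)
  ultimately show ?thesis
    unfolding equivariant_mean_def is_mean_def using continuous_M by blast
qed

end

section \<open>Averaging maps to make them equivariant\<close>

text \<open>
  The map \<open>z \<mapsto> \<alpha> (F (\<gamma> z))\<close> is the image of \<open>F\<close> under the involution that \<open>\<alpha>\<close> and \<open>\<gamma>\<close> induce on maps;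
  its fixed points are the equivariant maps, and a commutative equivariant operation applied to \<open>F\<close>
  and its image lands among them.
\<close>

lemma equivariant_averaging:
  fixes \<alpha> :: "'a::topological_space \<Rightarrow> 'a"
  assumes m: "equivariant_mean \<alpha> m" and \<alpha>: "involution euclidean \<alpha>"
    and \<gamma>: "involution Z \<gamma>" and F: "continuous_map Z euclidean F"
  obtains G where "continuous_map Z euclidean G" "equivariant_on (topspace Z) \<gamma> \<alpha> G"
    "\<And>z. F (\<gamma> z) = \<alpha> (F z) \<Longrightarrow> G z = F z"
proof
  define G where "G = (\<lambda>z. m (F z, \<alpha> (F (\<gamma> z))))"
  have m_cont: "continuous_map euclidean euclidean m"
    and m_idem: "m (x, x) = x" and m_eq: "m (\<alpha> x, \<alpha> y) = \<alpha> (m (x, y))" for x y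
    using m by (simp_all add: equivariant_mean_def is_mean_def)
  have m_comm: "m (x, y) = m (y, x)" for x y
    using m unfolding equivariant_mean_def is_mean_def by blast
  have \<alpha>_cont: "continuous_map euclidean euclidean \<alpha>" and \<alpha>_inv: "\<alpha> (\<alpha> x) = x" for x
    using \<alpha> by (auto simp: involution_def)
  have \<gamma>_cont: "continuous_map Z Z \<gamma>" and \<gamma>_inv: "z \<in> topspace Z \<Longrightarrow> \<gamma> (\<gamma> z) = z" for z
    using \<gamma> by (auto simp: involution_def)
  have "continuous_map Z euclidean (\<alpha> \<circ> (F \<circ> \<gamma>))"
    by (intro continuous_map_compose[OF _ \<alpha>_cont] continuous_map_compose[OF \<gamma>_cont F])
  then have "continuous_map Z (prod_topology euclidean euclidean) (\<lambda>z. (F z, \<alpha> (F (\<gamma> z))))"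
    using F unfolding continuous_map_pairwise o_def by simp
  then show "continuous_map Z euclidean G"
    using continuous_map_compose[OF _ m_cont] by (force simp: G_def o_def)
  show "equivariant_on (topspace Z) \<gamma> \<alpha> G"
    unfolding equivariant_on_def
  proof
    fix z
    assume "z \<in> topspace Z"
    then have "G (\<gamma> z) = m (F (\<gamma> z), \<alpha> (F z))"
      by (simp add: G_def \<gamma>_inv)
    also have "\<dots> = m (\<alpha> (F z), \<alpha> (\<alpha> (F (\<gamma> z))))"
      using m_comm by (simp add: \<alpha>_inv)
    also have "\<dots> = \<alpha> (G z)"
      unfolding m_eq G_def ..
    finally show "G (\<gamma> z) = \<alpha> (G z)" .
  qed
  show "G z = F z" if "F (\<gamma> z) = \<alpha> (F z)" for z
    by (simp add: G_def that \<alpha>_inv m_idem)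
qed

lemma Z2_absolute_extensor_if_equivariant_mean:
  fixes \<alpha> :: "'a::topological_space \<Rightarrow> 'a"
  assumes m: "equivariant_mean \<alpha> m" and \<alpha>: "involution euclidean \<alpha>"
    and AE: "absolute_extensor TYPE('z) (euclidean :: 'a topology)"
  shows "Z2_absolute_extensor TYPE('z) euclidean \<alpha>"
  unfolding Z2_absolute_extensor_def
proof (intro allI impI, elim conjE)
  fix Z :: "'z topology" and \<gamma> A and f :: "'z \<Rightarrow> 'a"
  assume Z: "metrizable_space Z" "closedin Z A" "continuous_map (subtopology Z A) euclidean f"
    and \<gamma>: "involution Z \<gamma>" and A: "invariant_under \<gamma> A" and f: "equivariant_on A \<gamma> \<alpha> f"
  obtain F where F: "continuous_map Z euclidean F" "\<forall>a\<in>A. F a = f a"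
    using AE Z unfolding absolute_extensor_def by blast
  obtain G where G: "continuous_map Z euclidean G" "equivariant_on (topspace Z) \<gamma> \<alpha> G"
    "\<And>z. F (\<gamma> z) = \<alpha> (F z) \<Longrightarrow> G z = F z"
    using equivariant_averaging[OF m \<alpha> \<gamma> F(1)] by blast
  have "G a = f a" if "a \<in> A" for a
  proof -
    have "\<gamma> a \<in> A"
      using A that by (auto simp: invariant_under_def)
    then have "F (\<gamma> a) = \<alpha> (F a)"
      using F(2) f that by (simp add: equivariant_on_def)
    then show ?thesis
      using G(3) F(2) that by simp
  qed
  with G show "\<exists>F. continuous_map Z euclidean F \<and> equivariant_on (topspace Z) \<gamma> \<alpha> F \<and>
      (\<forall>a\<in>A. F a = f a)"
    by blast
qed

lemma Z2_absolute_retract_if_equivariant_mean: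
  fixes \<alpha> :: "'a::topological_space \<Rightarrow> 'a"
  assumes m: "equivariant_mean \<alpha> m" and \<alpha>: "involution euclidean \<alpha>"
    and AR: "absolute_retract TYPE('z) (euclidean :: 'a topology)"
  shows "Z2_absolute_retract TYPE('z) euclidean \<alpha>"
  unfolding Z2_absolute_retract_def
proof (intro conjI allI impI, goal_cases)
  case 1
  show ?case
    using AR by (simp add: absolute_retract_def)
next
  case (2 Z \<gamma> e)
  then have \<gamma>: "involution Z \<gamma>" and e: "\<And>y. e (\<alpha> y) = \<gamma> (e y)"
    by (auto simp: equivariant_on_def)
  have "\<exists>r. continuous_map Z euclidean r \<and> (\<forall>y\<in>topspace euclidean. r (e y) = y)"
    using AR 2 unfolding absolute_retract_def by blast
  then obtain r where r: "continuous_map Z euclidean r" "\<And>y. r (e y) = y"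
    by auto
  obtain G where G: "continuous_map Z euclidean G" "equivariant_on (topspace Z) \<gamma> \<alpha> G"
    "\<And>z. r (\<gamma> z) = \<alpha> (r z) \<Longrightarrow> G z = r z"
    using equivariant_averaging[OF m \<alpha> \<gamma> r(1)] by blast
  have "G (e y) = y" for y
    using G(3)[of "e y"] r(2)[of y] r(2)[of "\<alpha> y"] e[of y] by simp
  with G show ?case
    by blast
qed

section \<open>Existence of equivariant means, extensions and retractions\<close>

theorem theorem4p15:
  fixes \<alpha> :: "'a::{t2_space, lattice} \<Rightarrow> 'a"
  assumes "Z2_decreasing_lattice \<alpha>"
    and "locally_order_convex TYPE('a)"
    and "countably_Dini TYPE('a)"
    and "sigma_monotonically_conditionally_complete TYPE('a)"
    and "(\<exists>q. RS_order_preserving_mean q \<and> arithmetic_wrt \<alpha> q) \<or>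
         (\<exists>q. LS_order_preserving_mean q \<and> harmonic_wrt \<alpha> q)"
  shows "(\<exists>q. equivariant_mean \<alpha> q) \<and>
         (absolute_retract TYPE('z) (euclidean :: 'a topology) \<longrightarrow>
            Z2_absolute_retract TYPE('z) euclidean \<alpha>) \<and>
         (absolute_extensor TYPE('z) (euclidean :: 'a topology) \<longrightarrow>
            Z2_absolute_extensor TYPE('z) euclidean \<alpha>)"
proof -
  interpret Z2_lattice \<alpha>
    using assms(1) by unfold_locales
  obtain q where q: "RS_order_preserving_mean q" "arithmetic_wrt \<alpha> q"
    using assms(5) RS_conjugate_of_LS arithmetic_conjugate_iff by blast
  interpret compound_mean \<alpha> q
    using assms(2-4) q by unfold_locales
  show ?thesis
    using equivariant_mean_M involution Z2_absolute_extensor_if_equivariant_mean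
      Z2_absolute_retract_if_equivariant_mean by blast
qed

end
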